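(* Let $d\ge1$ and $I_1,\dots,I_d\ge1$ be integers, $L=I_1I_2\cdots I_d$, and let $1\le M<L$. Let $\mathcal{X}$ be a random tensor with values in $\mathbb{R}^{I_1\times\cdots\times I_d}$ with $E\{\|\mathcal{X}\|^2\}<\infty$ and covariance $\mathcal{R}_{\mathbf{i},\mathbf{j}}=E\{\mathcal{X}_{\mathbf{i}}\mathcal{X}_{\mathbf{j}}\}$. Let $\{\mathcal{U}_{\cdot,l}\}_{l=1}^{L}$ be an orthonormal basis of $\mathbb{R}^{I_1\times\cdots\times I_d}$ satisfying $\sum_{\mathbf{j}}\mathcal{R}_{\mathbf{i},\mathbf{j}}\,\mathcal{U}_{\mathbf{j},l}=\lambda_l\,\mathcal{U}_{\mathbf{i},l}$ for all $\mathbf{i}$ and $l=1,\dots,L$, and let $\hat{\mathcal{X}}=\sum_{l=1}^{M}\langle\mathcal{X},\mathcal{U}_{\cdot,l}\rangle\,\mathcal{U}_{\cdot,l}$. Then $$E\{\|\mathcal{X}-\hat{\mathcal{X}}\|^2\}=\sum_{p=M+1}^{L}\lambda_p ,$$ and, among all orderings of the basis elements, this error is minimum when $\lambda_{M+1},\dots,\lambda_L$ are the lowest $L-M$ eigenvalues, equivalently when the eigenvalues $\lambda_1,\dots,\lambda_M$ of the basis elements used in $\hat{\mathcal{X}}$ are the $M$ highest (counted with multiplicity).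
   Context: An order-$d$ tensor in $\mathbb{R}^{I_1\times\cdots\times I_d}$ is a real array with entries indexed by multi-indices $\mathbf{i}=(i_1,\dots,i_d)$, $1\le i_k\le I_k$. The inner product is $\langle\mathcal{X},\mathcal{Y}\rangle=\sum_{\mathbf{i}}\mathcal{X}_{\mathbf{i}}\mathcal{Y}_{\mathbf{i}}$ and $\|\mathcal{X}\|=\sqrt{\langle\mathcal{X},\mathcal{X}\rangle}$. $\mathcal{U}_{\mathbf{i},l}$ denotes the $\mathbf{i}$ entry of the $l$-th basis tensor $\mathcal{U}_{\cdot,l}$; orthonormal means $\sum_{\mathbf{i}}\mathcal{U}_{\mathbf{i},l}\mathcal{U}_{\mathbf{i},l'}=\delta_{l,l'}$. $E\{\cdot\}$ is expectation. *)

theory Defs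
  imports
    "HOL-Probability.Probability"
    "HOL-Combinatorics.Permutations"
    "HOL-Library.Multiset"
begin

type_synonym multi_index = "nat \<Rightarrow> nat"
type_synonym tensor = "multi_index \<Rightarrow> real"

definition multi_indices :: "nat \<Rightarrow> (nat \<Rightarrow> nat) \<Rightarrow> multi_index set" where
  "multi_indices d I = (\<Pi>\<^sub>E k\<in>{1..d}. {1..I k})"

text \<open>Tensors are extensional, i.e. they take the value \<^term>\<open>undefined\<close> off the index
  set, so each real array is represented by exactly one function.\<close>

definition tensors :: "nat \<Rightarrow> (nat \<Rightarrow> nat) \<Rightarrow> tensor set" where
  "tensors d I = (multi_indices d I \<rightarrow>\<^sub>E (UNIV :: real set))"

definition tensor_inner :: "nat \<Rightarrow> (nat \<Rightarrow> nat) \<Rightarrow> tensor \<Rightarrow> tensor \<Rightarrow> real" where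
  "tensor_inner d I X Y = (\<Sum>i\<in>multi_indices d I. X i * Y i)"

definition tensor_norm :: "nat \<Rightarrow> (nat \<Rightarrow> nat) \<Rightarrow> tensor \<Rightarrow> real" where
  "tensor_norm d I X = sqrt (tensor_inner d I X X)"

text \<open>The underlying set of the product measurable space is \<^term>\<open>tensors d I\<close>.\<close>

definition random_tensor ::
  "'w measure \<Rightarrow> nat \<Rightarrow> (nat \<Rightarrow> nat) \<Rightarrow> ('w \<Rightarrow> tensor) \<Rightarrow> bool" where
  "random_tensor P d I X \<longleftrightarrow> X \<in> P \<rightarrow>\<^sub>M (\<Pi>\<^sub>M i\<in>multi_indices d I. (borel :: real measure))"

text \<open>Uncentered: the mean is not subtracted.\<close>

definition tensor_cov ::
  "'w measure \<Rightarrow> ('w \<Rightarrow> tensor) \<Rightarrow> multi_index \<Rightarrow> multi_index \<Rightarrow> real" where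
  "tensor_cov P X i j = (LINT \<omega>|P. X \<omega> i * X \<omega> j)"

definition orthonormal_tensor_basis ::
  "nat \<Rightarrow> (nat \<Rightarrow> nat) \<Rightarrow> nat \<Rightarrow> (nat \<Rightarrow> tensor) \<Rightarrow> bool" where
  "orthonormal_tensor_basis d I L U \<longleftrightarrow>
     (\<forall>l\<in>{1..L}. U l \<in> tensors d I) \<and>
     (\<forall>l\<in>{1..L}. \<forall>l'\<in>{1..L}. tensor_inner d I (U l) (U l') = (if l = l' then 1 else 0)) \<and>
     (\<forall>Y\<in>tensors d I. \<exists>c :: nat \<Rightarrow> real.
        \<forall>i\<in>multi_indices d I. Y i = (\<Sum>l=1..L. c l * U l i))"

definition tensor_truncation ::
  "nat \<Rightarrow> (nat \<Rightarrow> nat) \<Rightarrow> nat \<Rightarrow> (nat \<Rightarrow> tensor) \<Rightarrow> tensor \<Rightarrow> tensor" where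
  "tensor_truncation d I M U Y =
     (\<lambda>i\<in>multi_indices d I. \<Sum>l=1..M. tensor_inner d I Y (U l) * U l i)"

definition truncation_mse ::
  "'w measure \<Rightarrow> nat \<Rightarrow> (nat \<Rightarrow> nat) \<Rightarrow> nat \<Rightarrow> (nat \<Rightarrow> tensor) \<Rightarrow> ('w \<Rightarrow> tensor) \<Rightarrow> real" where
  "truncation_mse P d I M U X =
     (LINT \<omega>|P. (tensor_norm d I
        (\<lambda>i\<in>multi_indices d I. X \<omega> i - tensor_truncation d I M U (X \<omega>) i))\<^sup>2)"

definition lowest :: "nat \<Rightarrow> real multiset \<Rightarrow> real multiset" where
  "lowest k A = mset (take k (sorted_list_of_multiset A))"

definition highest :: "nat \<Rightarrow> real multiset \<Rightarrow> real multiset" where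
  "highest k A = mset (take k (rev (sorted_list_of_multiset A)))"

text \<open>The eigenvalues \<open>lam l\<close> for \<open>l \<in> S\<close>, counted with multiplicity.\<close>

definition eigenvalues_on :: "(nat \<Rightarrow> real) \<Rightarrow> nat set \<Rightarrow> real multiset" where
  "eigenvalues_on lam S = image_mset lam (mset_set S)"

end

theory Submission
  imports Defs
begin

text \<open>By Parseval the squared truncation error is the sum of the squares of the discarded
  coefficients, and the second moment of the \<open>l\<close>-th coefficient is the quadratic form of the
  covariance at the \<open>l\<close>-th basis tensor, i.e. its eigenvalue. Optimality is then the fact that
  the \<open>k\<close> lowest elements of a multiset have the least sum among its submultisets of size \<open>k\<close>.\<close>

section \<open>Inner products, orthonormal expansions and the truncation residual\<close>

lemma finite_multi_indices: "finite (multi_indices d I)"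
  by (simp add: multi_indices_def finite_PiE)

lemma tensor_inner_cong:
  assumes "\<And>i. i \<in> multi_indices d I \<Longrightarrow> X i = X' i"
    and "\<And>i. i \<in> multi_indices d I \<Longrightarrow> Y i = Y' i"
  shows "tensor_inner d I X Y = tensor_inner d I X' Y'"
  using assms by (simp add: tensor_inner_def)

lemma tensor_inner_commute: "tensor_inner d I X Y = tensor_inner d I Y X"
  by (simp add: tensor_inner_def mult.commute)

lemma tensor_inner_sum_left:
  "tensor_inner d I (\<lambda>i. \<Sum>l\<in>S. c l * U l i) Z = (\<Sum>l\<in>S. c l * tensor_inner d I (U l) Z)"
  unfolding tensor_inner_def sum_distrib_right sum_distrib_left
  by (subst sum.swap) (simp add: mult.assoc)

lemma tensor_norm_power2: "(tensor_norm d I X)\<^sup>2 = tensor_inner d I X X"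
  by (simp add: tensor_norm_def tensor_inner_def sum_nonneg)

text \<open>Orthonormality kills every term but the \<open>l\<close>-th. The index set
  \<open>S\<close> is left free because both the full expansion and its tail beyond \<open>M\<close>
  are needed.\<close>

lemma tensor_inner_orthonormal_sum:
  assumes "orthonormal_tensor_basis d I L U" "S \<subseteq> {1..L}" "l \<in> {1..L}"
  shows "tensor_inner d I (\<lambda>i. \<Sum>m\<in>S. c m * U m i) (U l) = (if l \<in> S then c l else 0)"
proof -
  have fin: "finite S"
    using assms(2) finite_subset by blast
  have "tensor_inner d I (\<lambda>i. \<Sum>m\<in>S. c m * U m i) (U l)
      = (\<Sum>m\<in>S. if m = l then c m else 0)"
    unfolding tensor_inner_sum_left
    using assms by (intro sum.cong refl) (auto simp: orthonormal_tensor_basis_def)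
  then show ?thesis
    using fin by simp
qed

text \<open>The truncation removes the first \<open>M\<close> terms of the expansion of
  \<open>Y\<close>, so the residual is the tail of that expansion, and Parseval applied to the tail
  gives its squared norm.\<close>

lemma truncation_residual:
  assumes basis: "orthonormal_tensor_basis d I L U" and "M \<le> L" and "Y \<in> tensors d I"
  shows "(tensor_norm d I (\<lambda>i\<in>multi_indices d I. Y i - tensor_truncation d I M U Y i))\<^sup>2
    = (\<Sum>l=M+1..L. (tensor_inner d I Y (U l))\<^sup>2)"
proof -
  obtain c :: "nat \<Rightarrow> real"
    where c: "\<And>i. i \<in> multi_indices d I \<Longrightarrow> Y i = (\<Sum>l=1..L. c l * U l i)"
    using basis assms(3) unfolding orthonormal_tensor_basis_def by blast
  \<comment> \<open>Spanning only yields some coefficients \<open>c\<close>; orthonormality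
    identifies them with the inner products used by the truncation.\<close>
  have coeff: "tensor_inner d I Y (U l) = c l" if "l \<in> {1..L}" for l
    using tensor_inner_orthonormal_sum[OF basis subset_refl that, of c] that
      tensor_inner_cong[OF c refl] by simp
  \<comment> \<open>\<open>D\<close> is the tail without restriction to the index set. Inner
    products see only entries on that set, so \<open>D\<close> can replace the extensional
    residual.\<close>
  define D where "D = (\<lambda>i. \<Sum>l\<in>{M+1..L}. c l * U l i)"
  have D: "Y i - tensor_truncation d I M U Y i = D i" if i: "i \<in> multi_indices d I" for i
  proof -
    have "tensor_truncation d I M U Y i = (\<Sum>l=1..M. c l * U l i)"
      using i coeff \<open>M \<le> L\<close> by (auto simp: tensor_truncation_def intro!: sum.cong)
    moreover have "{1..L} = {1..M} \<union> {M+1..L}"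
      using \<open>M \<le> L\<close> by auto
    then have "Y i = (\<Sum>l=1..M. c l * U l i) + D i"
      unfolding D_def c[OF i] by (simp add: sum.union_disjoint)
    ultimately show ?thesis
      by simp
  qed
  have "tensor_inner d I (\<lambda>i\<in>multi_indices d I. Y i - tensor_truncation d I M U Y i)
      (\<lambda>i\<in>multi_indices d I. Y i - tensor_truncation d I M U Y i) = tensor_inner d I D D"
    by (intro tensor_inner_cong) (simp_all add: D)
  \<comment> \<open>Only the left factor is expanded; the intact right factor then meets each
    \<open>U l\<close> and returns the coefficient \<open>c l\<close> a second time.\<close>
  also have "\<dots> = (\<Sum>l=M+1..L. c l * tensor_inner d I D (U l))"
    by (subst (1) D_def, unfold tensor_inner_sum_left) (simp add: tensor_inner_commute)
  also have "\<dots> = (\<Sum>l=M+1..L. (tensor_inner d I Y (U l))\<^sup>2)"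
  proof (intro sum.cong refl)
    fix l assume l: "l \<in> {M+1..L}"
    then have "tensor_inner d I D (U l) = c l"
      unfolding D_def by (subst tensor_inner_orthonormal_sum[OF basis]) auto
    then show "c l * tensor_inner d I D (U l) = (tensor_inner d I Y (U l))\<^sup>2"
      using l coeff by (simp add: power2_eq_square)
  qed
  finally show ?thesis
    by (simp only: tensor_norm_power2)
qed

section \<open>Second moments of the coefficients\<close>

lemma random_tensor_component_measurable:
  assumes "random_tensor P d I X" "i \<in> multi_indices d I"
  shows "(\<lambda>\<omega>. X \<omega> i) \<in> borel_measurable P"
  using measurable_compose[OF assms(1)[unfolded random_tensor_def]
      measurable_component_singleton[OF assms(2)]] .

lemma random_tensor_in_tensors:
  assumes "random_tensor P d I X" "\<omega> \<in> space P"
  shows "X \<omega> \<in> tensors d I"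
  using measurable_space[OF assms(1)[unfolded random_tensor_def] assms(2)]
  by (simp add: space_PiM tensors_def)

text \<open>Domination by the squared norm: \<open>2 * (\<bar>a\<bar> * \<bar>b\<bar>)\<close> is at
  most the sum of the two squares, and each squared entry is at most the squared norm.\<close>

lemma integrable_component_mult:
  assumes X: "random_tensor P d I X"
    and int: "integrable P (\<lambda>\<omega>. (tensor_norm d I (X \<omega>))\<^sup>2)"
    and i: "i \<in> multi_indices d I" and j: "j \<in> multi_indices d I"
  shows "integrable P (\<lambda>\<omega>. X \<omega> i * X \<omega> j)"
proof (rule Bochner_Integration.integrable_bound[OF int])
  show "(\<lambda>\<omega>. X \<omega> i * X \<omega> j) \<in> borel_measurable P"
    by (rule borel_measurable_times[OF random_tensor_component_measurable[OF X i]
          random_tensor_component_measurable[OF X j]])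
  have "norm (X \<omega> i * X \<omega> j) \<le> norm ((tensor_norm d I (X \<omega>))\<^sup>2)" for \<omega>
  proof -
    have le: "(X \<omega> k)\<^sup>2 \<le> tensor_inner d I (X \<omega>) (X \<omega>)" if "k \<in> multi_indices d I" for k
      using member_le_sum[OF that, of "\<lambda>k. X \<omega> k * X \<omega> k"] finite_multi_indices
      by (simp add: tensor_inner_def power2_eq_square)
    have "2 * (\<bar>X \<omega> i\<bar> * \<bar>X \<omega> j\<bar>) \<le> (X \<omega> i)\<^sup>2 + (X \<omega> j)\<^sup>2"
      using sum_squares_bound[of "\<bar>X \<omega> i\<bar>" "\<bar>X \<omega> j\<bar>"] by (simp add: mult.assoc)
    then show ?thesis
      using le[OF i] le[OF j] by (simp add: tensor_norm_power2 abs_mult del: power2_abs)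
  qed
  then show "AE \<omega> in P. norm (X \<omega> i * X \<omega> j) \<le> norm ((tensor_norm d I (X \<omega>))\<^sup>2)"
    by simp
qed

text \<open>The squared inner product is a finite double sum of products of entries of
  \<open>X \<omega>\<close>. Each product is integrable, so the expectation can be taken termwise,
  which produces the quadratic form of the covariance at \<open>V\<close>.\<close>

lemma tensor_inner_second_moment:
  assumes X: "random_tensor P d I X"
    and int: "integrable P (\<lambda>\<omega>. (tensor_norm d I (X \<omega>))\<^sup>2)"
  shows "integrable P (\<lambda>\<omega>. (tensor_inner d I (X \<omega>) V)\<^sup>2)"
    and "(LINT \<omega>|P. (tensor_inner d I (X \<omega>) V)\<^sup>2)
      = (\<Sum>i\<in>multi_indices d I. V i * (\<Sum>j\<in>multi_indices d I. tensor_cov P X i j * V j))"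
proof -
  have expand: "(tensor_inner d I (X \<omega>) V)\<^sup>2
      = (\<Sum>i\<in>multi_indices d I. \<Sum>j\<in>multi_indices d I. (V i * V j) * (X \<omega> i * X \<omega> j))" for \<omega>
    by (simp add: tensor_inner_def power2_eq_square sum_product mult_ac)
  have int': "integrable P (\<lambda>\<omega>. (V i * V j) * (X \<omega> i * X \<omega> j))"
    if "i \<in> multi_indices d I" "j \<in> multi_indices d I" for i j
    using integrable_component_mult[OF X int that] by (intro integrable_mult_right)
  show "integrable P (\<lambda>\<omega>. (tensor_inner d I (X \<omega>) V)\<^sup>2)"
    unfolding expand by (intro Bochner_Integration.integrable_sum int')
  show "(LINT \<omega>|P. (tensor_inner d I (X \<omega>) V)\<^sup>2)
      = (\<Sum>i\<in>multi_indices d I. V i * (\<Sum>j\<in>multi_indices d I. tensor_cov P X i j * V j))"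
  proof -
    have "(LINT \<omega>|P. (tensor_inner d I (X \<omega>) V)\<^sup>2)
        = (\<Sum>i\<in>multi_indices d I. \<Sum>j\<in>multi_indices d I. V i * V j * tensor_cov P X i j)"
      unfolding expand tensor_cov_def
      by (simp only: Bochner_Integration.integral_sum Bochner_Integration.integrable_sum int'
          integral_mult_right_zero cong: sum.cong)
    then show ?thesis
      by (simp add: sum_distrib_left mult_ac)
  qed
qed

lemma truncation_mse_eq_sum_eigenvalues:
  assumes X: "random_tensor P d I X"
    and int: "integrable P (\<lambda>\<omega>. (tensor_norm d I (X \<omega>))\<^sup>2)"
    and basis: "orthonormal_tensor_basis d I L U" and "M \<le> L"
    and eigen: "\<forall>l\<in>{1..L}. \<forall>i\<in>multi_indices d I.
      (\<Sum>j\<in>multi_indices d I. tensor_cov P X i j * U l j) = lam l * U l i"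
  shows "truncation_mse P d I M U X = (\<Sum>p=M+1..L. lam p)"
proof -
  have moment: "(LINT \<omega>|P. (tensor_inner d I (X \<omega>) (U l))\<^sup>2) = lam l" if l: "l \<in> {1..L}" for l
  proof -
    have "(LINT \<omega>|P. (tensor_inner d I (X \<omega>) (U l))\<^sup>2)
        = (\<Sum>i\<in>multi_indices d I. U l i * (lam l * U l i))"
      unfolding tensor_inner_second_moment(2)[OF X int] using eigen l
      by (intro sum.cong refl) simp
    also have "\<dots> = lam l * tensor_inner d I (U l) (U l)"
      by (simp add: tensor_inner_def sum_distrib_left mult_ac)
    also have "\<dots> = lam l"
      using basis l by (simp add: orthonormal_tensor_basis_def)
    finally show ?thesis .
  qed
  \<comment> \<open>The residual identity is applied pointwise on \<open>space P\<close>, where the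
    values of \<open>X\<close> are genuine tensors.\<close>
  have "truncation_mse P d I M U X
      = (LINT \<omega>|P. (\<Sum>l=M+1..L. (tensor_inner d I (X \<omega>) (U l))\<^sup>2))"
    unfolding truncation_mse_def
    by (intro Bochner_Integration.integral_cong refl
        truncation_residual[OF basis \<open>M \<le> L\<close>] random_tensor_in_tensors[OF X])
  also have "\<dots> = (\<Sum>l=M+1..L. (LINT \<omega>|P. (tensor_inner d I (X \<omega>) (U l))\<^sup>2))"
    by (intro Bochner_Integration.integral_sum tensor_inner_second_moment(1)[OF X int])
  also have "\<dots> = (\<Sum>p=M+1..L. lam p)"
    by (intro sum.cong refl moment) auto
  finally show ?thesis .
qed

section \<open>Reorderings of the basis\<close>

lemma orthonormal_tensor_basis_permute:
  assumes basis: "orthonormal_tensor_basis d I L U" and \<sigma>: "\<sigma> permutes {1..L}"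
  shows "orthonormal_tensor_basis d I L (U \<circ> \<sigma>)"
  unfolding orthonormal_tensor_basis_def
proof (intro conjI ballI)
  fix l assume l: "l \<in> {1..L}"
  then have \<sigma>l: "\<sigma> l \<in> {1..L}"
    using permutes_in_image[OF \<sigma>] by blast
  then show "(U \<circ> \<sigma>) l \<in> tensors d I"
    using basis by (simp add: orthonormal_tensor_basis_def)
  fix l' assume l': "l' \<in> {1..L}"
  then have "\<sigma> l' \<in> {1..L}"
    using permutes_in_image[OF \<sigma>] by blast
  moreover have "\<sigma> l = \<sigma> l' \<longleftrightarrow> l = l'"
    using permutes_inj[OF \<sigma>] by (auto dest: injD)
  ultimately show "tensor_inner d I ((U \<circ> \<sigma>) l) ((U \<circ> \<sigma>) l') = (if l = l' then 1 else 0)"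
    using basis \<sigma>l by (simp add: orthonormal_tensor_basis_def)
next
  fix Y assume "Y \<in> tensors d I"
  then obtain c :: "nat \<Rightarrow> real"
    where c: "\<And>i. i \<in> multi_indices d I \<Longrightarrow> Y i = (\<Sum>l=1..L. c l * U l i)"
    using basis unfolding orthonormal_tensor_basis_def by blast
  \<comment> \<open>The coefficients are permuted along with the basis; reindexing the sum by
    \<open>\<sigma>\<close> recovers the original expansion.\<close>
  have "Y i = (\<Sum>l=1..L. (c \<circ> \<sigma>) l * (U \<circ> \<sigma>) l i)" if "i \<in> multi_indices d I" for i
    using c[OF that] sum.permute[OF \<sigma>, of "\<lambda>l. c l * U l i"] by (simp add: o_def)
  then show "\<exists>c. \<forall>i\<in>multi_indices d I. Y i = (\<Sum>l=1..L. c l * (U \<circ> \<sigma>) l i)"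
    by blast
qed

section \<open>Lowest and highest elements of a multiset\<close>

text \<open>Induction on \<open>xs\<close> with \<open>B\<close> and \<open>k\<close> arbitrary: the
  head is at most every element of \<open>B\<close>, so one element of \<open>B\<close> is compared
  with the head and the rest with the tail.\<close>

lemma sum_list_take_sorted_le_sum_mset:
  fixes xs :: "real list"
  assumes "sorted xs" "B \<subseteq># mset xs" "size B = k"
  shows "sum_list (take k xs) \<le> sum_mset B"
  using assms
proof (induction xs arbitrary: k B)
  case Nil
  then show ?case by simp
next
  case (Cons x xs)
  show ?case
  proof (cases k)
    case 0
    then show ?thesis
      using Cons.prems by simp
  next
    case (Suc n)
    have "B \<noteq> {#}"
      using Cons.prems(3) Suc by auto
    \<comment> \<open>The element \<open>b\<close> compared with \<open>x\<close> is
      \<open>x\<close> itself if \<open>B\<close> contains it and arbitrary otherwise. This choice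
      makes the remainder of \<open>B\<close> fit inside \<open>mset xs\<close>.\<close>
    then obtain b where b: "b \<in># B" "b = x \<or> x \<notin># B"
      by (metis multiset_nonemptyE)
    then obtain B' where B: "B = add_mset b B'"
      by (metis insert_DiffM)
    have "B' \<subseteq># mset xs"
    proof (cases "b = x")
      case True
      then show ?thesis
        using Cons.prems(2) B by simp
    next
      case False
      then have "x \<notin># B"
        using b by simp
      then have "B \<subseteq># mset xs"
        using Cons.prems(2) by (simp add: inter_add_right1 subset_mset.inf.absorb_iff1)
      then show ?thesis
        using B by (meson mset_subset_eq_insertD subset_mset.less_imp_le)
    qed
    then have "sum_list (take n xs) \<le> sum_mset B'"
      using Cons.IH Cons.prems B Suc by simp
    moreover have "x \<le> b"
      using b(1) Cons.prems(1) mset_subset_eqD[OF Cons.prems(2)] by auto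
    ultimately show ?thesis
      using B Suc by simp
  qed
qed

lemma sum_mset_lowest_le:
  assumes "B \<subseteq># A" "size B = k"
  shows "sum_mset (lowest k A) \<le> sum_mset B"
  using sum_list_take_sorted_le_sum_mset[of "sorted_list_of_multiset A" B k] assms
  by (simp add: lowest_def sum_mset_sum_list)

text \<open>Taking \<open>m\<close> elements from the reversed sorted list amounts to dropping the
  first \<open>k\<close> from the sorted one, so the two pieces are complementary.\<close>

lemma lowest_plus_highest:
  assumes "k + m = size A"
  shows "lowest k A + highest m A = A"
proof -
  have "length (sorted_list_of_multiset A) - m = k"
    using assms by (metis add_diff_cancel_right' mset_sorted_list_of_multiset size_mset)
  then have "highest m A = mset (drop k (sorted_list_of_multiset A))"
    by (simp add: highest_def take_rev)
  then show ?thesis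
    by (simp add: lowest_def flip: mset_append)
qed

text \<open>Both \<open>C + B\<close> and the split into highest and lowest elements sum to
  \<open>A\<close>; by cancellation, agreement of one summand forces agreement of the other.\<close>

lemma eq_lowest_iff_eq_highest:
  assumes "A = C + B" "size B = k" "size C = m"
  shows "B = lowest k A \<longleftrightarrow> C = highest m A"
proof -
  have "lowest k A + highest m A = C + B"
    using lowest_plus_highest[of k m A] assms by simp
  then show ?thesis
    by (metis add.commute add_left_cancel)
qed

theorem mainTheorem3:
  fixes d L M :: nat
    and I :: "nat \<Rightarrow> nat"
    and P :: "'w measure"
    and X :: "'w \<Rightarrow> tensor"
    and U :: "nat \<Rightarrow> tensor"
    and lam :: "nat \<Rightarrow> real"
  assumes "1 \<le> d"
    and "\<forall>k\<in>{1..d}. 1 \<le> I k"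
    and "L = (\<Prod>k=1..d. I k)"
    and "1 \<le> M" and "M < L"
    and "prob_space P"
    and "random_tensor P d I X"
    and "integrable P (\<lambda>\<omega>. (tensor_norm d I (X \<omega>))\<^sup>2)"
    and "orthonormal_tensor_basis d I L U"
    and "\<forall>l\<in>{1..L}. \<forall>i\<in>multi_indices d I.
           (\<Sum>j\<in>multi_indices d I. tensor_cov P X i j * U l j) = lam l * U l i"
  shows "truncation_mse P d I M U X = (\<Sum>p=M+1..L. lam p) \<and>
    (eigenvalues_on lam {M+1..L} = lowest (L - M) (eigenvalues_on lam {1..L}) \<longrightarrow>
       (\<forall>\<sigma>. \<sigma> permutes {1..L} \<longrightarrow>
          truncation_mse P d I M U X \<le> truncation_mse P d I M (U \<circ> \<sigma>) X)) \<and>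
    (eigenvalues_on lam {M+1..L} = lowest (L - M) (eigenvalues_on lam {1..L}) \<longleftrightarrow>
       eigenvalues_on lam {1..M} = highest M (eigenvalues_on lam {1..L}))"
proof (intro conjI impI allI)
  \<comment> \<open>Basis and eigenvalues are generic here, to cover both \<open>U\<close> with
    \<open>lam\<close> and the reordered \<open>U \<circ> \<sigma>\<close> with
    \<open>lam \<circ> \<sigma>\<close>.\<close>
  have mse: "truncation_mse P d I M V X = (\<Sum>p=M+1..L. mu p)"
    if "orthonormal_tensor_basis d I L V"
      and "\<forall>l\<in>{1..L}. \<forall>i\<in>multi_indices d I.
        (\<Sum>j\<in>multi_indices d I. tensor_cov P X i j * V l j) = mu l * V l i" for V mu
    using truncation_mse_eq_sum_eigenvalues[OF assms(7,8) that(1) _ that(2)] assms(5) by simp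
  show eq: "truncation_mse P d I M U X = (\<Sum>p=M+1..L. lam p)"
    by (rule mse[OF assms(9,10)])
  {
    fix \<sigma>
    assume low: "eigenvalues_on lam {M+1..L} = lowest (L - M) (eigenvalues_on lam {1..L})"
      and \<sigma>: "\<sigma> permutes {1..L}"
    have "\<sigma> l \<in> {1..L}" if "l \<in> {1..L}" for l
      using permutes_in_image[OF \<sigma>] that by blast
    then have "truncation_mse P d I M (U \<circ> \<sigma>) X = (\<Sum>p=M+1..L. (lam \<circ> \<sigma>) p)"
      using assms(10) by (intro mse orthonormal_tensor_basis_permute[OF assms(9) \<sigma>]) simp
    also have "\<dots> = sum_mset (image_mset (lam \<circ> \<sigma>) (mset_set {M+1..L}))"
      by (rule sum_unfold_sum_mset)
    \<comment> \<open>Whatever the ordering, the discarded eigenvalues form a submultiset of size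
      \<open>L - M\<close> of one fixed spectrum.\<close>
    also have "\<dots> \<ge> sum_mset (lowest (L - M) (eigenvalues_on lam {1..L}))"
    proof (rule sum_mset_lowest_le)
      have "image_mset (lam \<circ> \<sigma>) (mset_set {M+1..L})
          \<subseteq># image_mset (lam \<circ> \<sigma>) (mset_set {1..L})"
        by (intro image_mset_subseteq_mono subset_imp_msubset_mset_set) auto
      \<comment> \<open>As \<open>\<sigma>\<close> maps \<open>{1..L}\<close> bijectively onto
        itself, the whole spectrum with multiplicities is unchanged.\<close>
      also have "\<dots> = image_mset lam (mset_set {1..L})"
        using permutes_image[OF \<sigma>]
        by (simp add: image_mset_mset_set[OF inj_on_subset[OF permutes_inj[OF \<sigma>]]]
            flip: multiset.map_comp)
      finally show "image_mset (lam \<circ> \<sigma>) (mset_set {M+1..L}) \<subseteq># eigenvalues_on lam {1..L}"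
        by (simp add: eigenvalues_on_def)
    qed simp
    finally show "truncation_mse P d I M U X \<le> truncation_mse P d I M (U \<circ> \<sigma>) X"
      unfolding low[symmetric] by (simp add: eq eigenvalues_on_def sum_unfold_sum_mset)
  }
  have "{1..L} = {1..M} \<union> {M+1..L}"
    using assms(5) by auto
  then have "eigenvalues_on lam {1..L} = eigenvalues_on lam {1..M} + eigenvalues_on lam {M+1..L}"
    by (simp add: eigenvalues_on_def mset_set_Union)
  then show "eigenvalues_on lam {M+1..L} = lowest (L - M) (eigenvalues_on lam {1..L}) \<longleftrightarrow>
      eigenvalues_on lam {1..M} = highest M (eigenvalues_on lam {1..L})"
    by (rule eq_lowest_iff_eq_highest) (simp_all add: eigenvalues_on_def)
qed

end
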